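(* Let $U\in\mathbb{R}^{n\times n}$. (a) Let $\rho\ge 0$ and $\mathcal{Z}=\{\Delta\in\mathbb{R}^{n\times n}:\ \|\Delta\|\le\rho\}$, where $\|\cdot\|$ is a general matrix norm. Then $\delta^*_{\mathcal{Z}}(U)=\rho\|U\|^*$. (b) Let $\mathcal{Z}=\{\Delta:\ \Delta^l\preceq\Delta\preceq\Delta^u\}$, where $\Delta^l,\Delta^u$ are given symmetric $n\times n$ matrices such that $\Delta^u-\Delta^l\succ 0_{n\times n}$. Then $$\delta^*_{\mathcal{Z}}(U)=\min_{\Lambda_1,\Lambda_2}\left\{\mathrm{trace}(\Delta^u\Lambda_2)-\mathrm{trace}(\Delta^l\Lambda_1):\ \Lambda_2-\Lambda_1=\frac{U+U^T}{2},\ \Lambda_1,\Lambda_2\succeq 0_{n\times n}\right\}.$$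
   Context: Support function: for a convex set $\mathcal{Z}\subseteq\mathbb{R}^{n\times n}$, $\delta^*_{\mathcal{Z}}(U):=\sup_{\Delta\in\mathcal{Z}}\mathrm{trace}(\Delta U^T)$. Dual norm of a matrix norm $\|\cdot\|$ (any norm on the vector space $\mathbb{R}^{n\times n}$): $\|A\|^*=\max_{\|B\|=1}\mathrm{trace}(B^TA)$. $M\succeq N$ (resp. $M\succ N$) means that $M-N$ is symmetric positive semi-definite (resp. symmetric positive definite); in particular the elements of $\mathcal{Z}$ in (b) are symmetric. *)

theory Defs
  imports "HOL-Analysis.Analysis"
begin

definition matrix_norm :: "(real^'n^'n \<Rightarrow> real) \<Rightarrow> bool" where
  "matrix_norm N \<longleftrightarrow>
     (\<forall>A. 0 \<le> N A) \<and> (\<forall>A. N A = 0 \<longleftrightarrow> A = 0) \<and>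
     (\<forall>c A. N (c *\<^sub>R A) = \<bar>c\<bar> * N A) \<and> (\<forall>A B. N (A + B) \<le> N A + N B)"

text \<open>The maximum is \<^const>\<open>Greatest\<close>; it is attained whenever \<open>N\<close> is a norm, see
  \<open>dual_norm_max\<close> below.\<close>

definition dual_norm :: "(real^'n^'n \<Rightarrow> real) \<Rightarrow> real^'n^'n \<Rightarrow> real" where
  "dual_norm N A = (GREATEST t. \<exists>B. N B = 1 \<and> t = trace (transpose B ** A))"

text \<open>Extended real values, so that the supremum is meaningful for unbounded sets as well.\<close>

definition support_function :: "(real^'n^'n) set \<Rightarrow> real^'n^'n \<Rightarrow> ereal" where
  "support_function Z U = (SUP D\<in>Z. ereal (trace (D ** transpose U)))"

definition psd :: "real^'n^'n \<Rightarrow> bool" where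
  "psd A \<longleftrightarrow> transpose A = A \<and> (\<forall>x. 0 \<le> x \<bullet> (A *v x))"

definition pd :: "real^'n^'n \<Rightarrow> bool" where
  "pd A \<longleftrightarrow> transpose A = A \<and> (\<forall>x. x \<noteq> 0 \<longrightarrow> 0 < x \<bullet> (A *v x))"

definition loewner_le :: "real^'n^'n \<Rightarrow> real^'n^'n \<Rightarrow> bool" (infix "\<preceq>\<^sub>L" 50) where
  "A \<preceq>\<^sub>L B \<longleftrightarrow> psd (B - A)"

definition loewner_less :: "real^'n^'n \<Rightarrow> real^'n^'n \<Rightarrow> bool" (infix "\<prec>\<^sub>L" 50) where
  "A \<prec>\<^sub>L B \<longleftrightarrow> pd (B - A)"

lemma matrix_norm_lipschitz:
  fixes N :: "real^'n^'n \<Rightarrow> real"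
  assumes N: "matrix_norm N"
  obtains C where "0 \<le> C" and "\<And>A B. \<bar>N A - N B\<bar> \<le> C * norm (A - B)"
proof
  have scale: "N (c *\<^sub>R A) = \<bar>c\<bar> * N A" and tri: "N (A + B) \<le> N A + N B"
    and nn: "0 \<le> N A" and zero: "N 0 = 0" for c A B
    using N unfolding matrix_norm_def by auto
  let ?C = "\<Sum>b\<in>Basis. N b"
  show "0 \<le> ?C" by (simp add: nn sum_nonneg)
  have bound: "N A \<le> ?C * norm A" for A
  proof -
    have sum_le: "N (\<Sum>b\<in>S. f b) \<le> (\<Sum>b\<in>S. N (f b))" if "finite S"
      for S and f :: "real^'n^'n \<Rightarrow> real^'n^'n"
      using that
    proof induction
      case (insert x F)
      then show ?case using tri[of "f x" "sum f F"] by simp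
    qed (simp add: zero)
    have "N A = N (\<Sum>b\<in>Basis. (A \<bullet> b) *\<^sub>R b)" by (simp add: euclidean_representation)
    also have "\<dots> \<le> (\<Sum>b\<in>Basis. N ((A \<bullet> b) *\<^sub>R b))" by (rule sum_le) simp
    also have "\<dots> \<le> (\<Sum>b\<in>Basis. norm A * N b)"
      by (rule sum_mono) (simp add: scale nn Basis_le_norm mult_right_mono)
    finally show ?thesis by (simp add: sum_distrib_left mult.commute)
  qed
  show "\<bar>N A - N B\<bar> \<le> ?C * norm (A - B)" for A B
  proof -
    have "N (B - A) = N (A - B)" using scale[of "-1" "A - B"] by simp
    then show ?thesis
      using tri[of "A - B" B] tri[of "B - A" A] bound[of "A - B"] by simp
  qed
qed

lemma dual_norm_max:
  fixes N :: "real^'n^'n \<Rightarrow> real"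
  assumes N: "matrix_norm N"
  shows "\<exists>B. N B = 1 \<and> dual_norm N A = trace (transpose B ** A)"
    and "N B = 1 \<Longrightarrow> trace (transpose B ** A) \<le> dual_norm N A"
proof -
  have scale: "N (c *\<^sub>R A) = \<bar>c\<bar> * N A"
    and nn: "0 \<le> N A" and zero: "N A = 0 \<longleftrightarrow> A = 0" for c A
    using N unfolding matrix_norm_def by auto
  obtain C where "0 \<le> C" and C: "\<And>A B. \<bar>N A - N B\<bar> \<le> C * norm (A - B)"
    using matrix_norm_lipschitz[OF N] by blast
  have cont: "continuous_on S N" for S
    by (rule lipschitz_on_continuous_on[where L=C], rule lipschitz_onI)
      (use \<open>0 \<le> C\<close> C in \<open>auto simp: dist_norm\<close>)
  have tr: "trace (transpose B ** A) = B \<bullet> A" for B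
    unfolding trace_def matrix_matrix_mult_def transpose_def inner_vec_def
    by simp (rule sum.swap)
  have "sphere (0::real^'n^'n) 1 \<noteq> {}" by simp
  then obtain X where X: "X \<in> sphere 0 1" "\<And>Y. Y \<in> sphere 0 1 \<Longrightarrow> N X \<le> N Y"
    using continuous_attains_inf[OF compact_sphere _ cont] by metis
  have "X \<noteq> 0" using X(1) by auto
  then have pos: "0 < N X" using nn[of X] zero[of X] by linarith
  have low: "N X * norm Y \<le> N Y" for Y
  proof (cases "Y = 0")
    case False
    then have "N X \<le> N ((1 / norm Y) *\<^sub>R Y)" by (intro X(2)) simp
    with False show ?thesis by (simp add: scale field_simps)
  qed (simp add: nn)
  have "closed {B. N B = 1}"
    using continuous_closed_preimage[OF cont[of UNIV], of "{1}"] by (simp add: vimage_def)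
  moreover have "bounded {B. N B = 1}"
    by (rule boundedI[where B="1 / N X"])
      (use low pos in \<open>auto simp: field_simps\<close>, metis)
  ultimately have "compact {B. N B = 1}" by (simp add: compact_eq_bounded_closed)
  moreover have "(1 / N X) *\<^sub>R X \<in> {B. N B = 1}" using pos by (simp add: scale)
  moreover have "continuous_on {B. N B = 1} (\<lambda>B. B \<bullet> A)" by (intro continuous_intros)
  ultimately obtain M where M: "N M = 1" "\<And>B. N B = 1 \<Longrightarrow> B \<bullet> A \<le> M \<bullet> A"
    using continuous_attains_sup[of "{B. N B = 1}" "\<lambda>B. B \<bullet> A"]
    by blast
  have dn: "dual_norm N A = M \<bullet> A"
    unfolding dual_norm_def tr by (rule Greatest_equality) (use M in auto)
  show "\<exists>B. N B = 1 \<and> dual_norm N A = trace (transpose B ** A)"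
    using M(1) dn tr by auto
  show "N B = 1 \<Longrightarrow> trace (transpose B ** A) \<le> dual_norm N A"
    using M(2) dn tr by simp
qed

end

theory Submission
  imports Defs
begin

text \<open>
  Part (a) is the inequality \<open>D \<bullet> U \<le> N D * dual_norm N U\<close> together with the fact that it is sharp.

  For part (b) let \<open>S\<close> be the symmetric part of \<open>U\<close> and \<open>W = Du - Dl\<close>. Diagonalizing \<open>S\<close> relative to
  \<open>W\<close> yields vectors \<open>u\<close> with \<open>u \<bullet> W v = \<delta>\<^sub>u\<^sub>v\<close>, \<open>S = (\<Sum>u. c\<^sub>u u u\<^sup>T)\<close> and \<open>W = (\<Sum>u. (W u) (W u)\<^sup>T)\<close>.
  Sorting both sums by the sign of \<open>c\<^sub>u\<close> gives semidefinite splittings \<open>S = Sp - Sm\<close> and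
  \<open>W = Wp + Wm\<close> with \<open>Sp \<bullet> Wm = Sm \<bullet> Wp = 0\<close>. Hence the dual point \<open>(Sm, Sp)\<close> and the primal point
  \<open>Dl + Wp = Du - Wm\<close> satisfy complementary slackness, so that both are optimal.
\<close>

section \<open>Simultaneous diagonalization of symmetric forms\<close>

lemma nonneg_form_null_vector:
  fixes q :: "'a::real_vector \<Rightarrow> 'a \<Rightarrow> real"
  assumes q: "bilinear q" and sym: "\<And>x y. q x y = q y x"
    and V: "subspace V" and nonneg: "\<And>x. x \<in> V \<Longrightarrow> 0 \<le> q x x"
    and u: "u \<in> V" "q u u = 0" and x: "x \<in> V"
  shows "q x u = 0"
proof (rule ccontr)
  assume nonzero: "q x u \<noteq> 0"
  define t where "t = - (q x x + 1) / (2 * q x u)"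
  have "0 \<le> q (x + t *\<^sub>R u) (x + t *\<^sub>R u)"
    by (intro nonneg subspace_add subspace_scale V u x)
  also have "\<dots> = q x x + 2 * t * q x u"
    using u(2) sym[of u x]
    by (simp add: bilinear_ladd[OF q] bilinear_radd[OF q] bilinear_lmul[OF q] bilinear_rmul[OF q])
  also have "\<dots> = - 1" using nonzero by (simp add: t_def field_simps)
  finally show False by simp
qed

lemma Rayleigh_quotient_attains_sup:
  fixes f g :: "'a::euclidean_space \<Rightarrow> 'a \<Rightarrow> real"
  assumes f: "bilinear f" and g: "bilinear g"
    and V: "subspace V" "V \<noteq> {0}"
    and pos: "\<And>x. x \<in> V \<Longrightarrow> x \<noteq> 0 \<Longrightarrow> 0 < g x x"
  obtains w where "w \<in> V" "w \<noteq> 0" "\<And>x. x \<in> V \<Longrightarrow> f x x \<le> f w w / g w w * g x x"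
proof -
  let ?K = "V \<inter> sphere 0 1"
  have normalize: "(1 / norm x) *\<^sub>R x \<in> ?K" if "x \<in> V" "x \<noteq> 0" for x
    using that V(1) by (simp add: subspace_scale)
  have "compact ?K" by (intro closed_Int_compact closed_subspace V compact_sphere)
  moreover have "?K \<noteq> {}" using V subspace_0 normalize by blast
  moreover have "g x x \<noteq> 0" if "x \<in> ?K" for x
    using pos[of x] that by (cases "x = 0") auto
  then have "continuous_on ?K (\<lambda>x. f x x / g x x)"
    using bilinear_continuous_on_compose[OF continuous_on_id continuous_on_id f]
      bilinear_continuous_on_compose[OF continuous_on_id continuous_on_id g]
    by (intro continuous_on_divide) auto
  ultimately obtain w where w: "w \<in> ?K" and max: "\<And>y. y \<in> ?K \<Longrightarrow> f y y / g y y \<le> f w w / g w w"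
    using continuous_attains_sup[of ?K "\<lambda>x. f x x / g x x"] by blast
  have "f x x \<le> f w w / g w w * g x x" if x: "x \<in> V" for x
  proof (cases "x = 0")
    case True
    then show ?thesis by (simp add: bilinear_lzero[OF f] bilinear_lzero[OF g])
  next
    case False
    then have "f x x / g x x \<le> f w w / g w w"
      using max[OF normalize[OF x False]]
      by (simp add: bilinear_lmul[OF f] bilinear_rmul[OF f] bilinear_lmul[OF g] bilinear_rmul[OF g])
    then show ?thesis using pos[OF x False] by (simp only: pos_divide_le_eq)
  qed
  moreover have "w \<in> V" "w \<noteq> 0" using w by auto
  ultimately show ?thesis using that by blast
qed

lemma symmetric_form_eigenvector:
  fixes f g :: "'a::euclidean_space \<Rightarrow> 'a \<Rightarrow> real"
  assumes f: "bilinear f" "\<And>x y. f x y = f y x"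
    and g: "bilinear g" "\<And>x y. g x y = g y x"
    and V: "subspace V" "V \<noteq> {0}"
    and pos: "\<And>x. x \<in> V \<Longrightarrow> x \<noteq> 0 \<Longrightarrow> 0 < g x x"
  obtains u where "u \<in> V" "g u u = 1" "\<And>x. x \<in> V \<Longrightarrow> f x u = f u u * g x u"
proof -
  obtain w where w: "w \<in> V" "w \<noteq> 0" and max: "\<And>x. x \<in> V \<Longrightarrow> f x x \<le> f w w / g w w * g x x"
    using Rayleigh_quotient_attains_sup[OF f(1) g(1) V pos] by blast
  have "0 < g w w" using w by (rule pos)
  define \<mu> where "\<mu> = f w w / g w w"
  \<comment> \<open>\<open>\<mu> g - f\<close> is nonnegative on \<open>V\<close> and vanishes at the maximizer \<open>w\<close>.\<close>
  have "bilinear (\<lambda>x y. \<mu> * g x y - f x y)"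
    using f(1) g(1) by (simp add: bilinear_def linear_iff algebra_simps)
  then have eigen: "f x w = \<mu> * g x w" if "x \<in> V" for x
    using nonneg_form_null_vector[of "\<lambda>x y. \<mu> * g x y - f x y" V w x]
      that w(1) \<open>0 < g w w\<close> max V(1) f(2) g(2)
    by (auto simp: \<mu>_def)
  define u where "u = (1 / sqrt (g w w)) *\<^sub>R w"
  note scale = bilinear_lmul[OF f(1)] bilinear_rmul[OF f(1)]
    bilinear_lmul[OF g(1)] bilinear_rmul[OF g(1)]
  have "g u u = 1" "f u u = \<mu>" using \<open>0 < g w w\<close> by (auto simp: u_def scale \<mu>_def)
  moreover have "u \<in> V" using w(1) V(1) by (simp add: u_def subspace_scale)
  moreover have "f x u = \<mu> * g x u" if "x \<in> V" for x
    using eigen[OF that] by (simp add: u_def scale)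
  ultimately show ?thesis using that by blast
qed

definition diagonal_basis ::
    "('a \<Rightarrow> 'a \<Rightarrow> real) \<Rightarrow> ('a \<Rightarrow> 'a \<Rightarrow> real) \<Rightarrow> 'a::real_vector set \<Rightarrow> 'a set \<Rightarrow> bool" where
  "diagonal_basis f g V B \<longleftrightarrow> finite B \<and> B \<subseteq> V \<and>
     (\<forall>u\<in>B. \<forall>v\<in>B. g u v = (if u = v then 1 else 0)) \<and>
     pairwise (\<lambda>u v. f u v = 0) B \<and>
     (\<forall>x\<in>V. (\<Sum>u\<in>B. g x u *\<^sub>R u) = x)"

lemma diagonal_basis_insert:
  fixes f g :: "'a::real_vector \<Rightarrow> 'a \<Rightarrow> real"
  assumes f: "\<And>x y. f x y = f y x"
    and g: "bilinear g" "\<And>x y. g x y = g y x"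
    and V: "subspace V"
    and u: "u \<in> V" "g u u = 1" and eigen: "\<And>x. x \<in> V \<Longrightarrow> f x u = c * g x u"
    and B: "diagonal_basis f g {x \<in> V. g x u = 0} B"
  shows "diagonal_basis f g V (insert u B)"
proof -
  have "finite B" and "B \<subseteq> V" and orthogonal_u: "\<And>v. v \<in> B \<Longrightarrow> g v u = 0"
    and orthonormal: "\<forall>v\<in>B. \<forall>w\<in>B. g v w = (if v = w then 1 else 0)"
    and diagonal: "pairwise (\<lambda>v w. f v w = 0) B"
    and expand: "\<And>y. y \<in> V \<Longrightarrow> g y u = 0 \<Longrightarrow> (\<Sum>v\<in>B. g y v *\<^sub>R v) = y"
    using B unfolding diagonal_basis_def by blast+
  have u_orthogonal: "g u v = 0" if "v \<in> B" for v
    using orthogonal_u[OF that] g(2)[of u v] by simp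
  have diagonal_u: "f v u = 0" "f u v = 0" if "v \<in> B" for v
    using that \<open>B \<subseteq> V\<close> orthogonal_u eigen[of v] f[of u v] by auto
  have "u \<notin> B" using orthogonal_u[of u] u(2) by auto
  have "(\<Sum>v\<in>insert u B. g x v *\<^sub>R v) = x" if "x \<in> V" for x
  proof -
    let ?y = "x - g x u *\<^sub>R u"
    have "?y \<in> V" using that u(1) V by (simp add: subspace_diff subspace_scale)
    moreover have g_y: "g ?y v = g x v - g x u * g u v" for v
      by (simp add: bilinear_lsub[OF g(1)] bilinear_lmul[OF g(1)])
    ultimately have "(\<Sum>v\<in>B. g ?y v *\<^sub>R v) = ?y" by (intro expand) (simp_all add: u(2))
    then have "(\<Sum>v\<in>B. g x v *\<^sub>R v) = ?y" by (simp add: g_y u_orthogonal)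
    then show ?thesis using \<open>finite B\<close> \<open>u \<notin> B\<close> by simp
  qed
  moreover have "pairwise (\<lambda>v w. f v w = 0) (insert u B)"
    using diagonal diagonal_u by (simp add: pairwise_insert)
  moreover have "\<forall>v\<in>insert u B. \<forall>w\<in>insert u B. g v w = (if v = w then 1 else 0)"
    using orthonormal orthogonal_u u_orthogonal u(2) \<open>u \<notin> B\<close> by auto
  ultimately show ?thesis
    unfolding diagonal_basis_def using \<open>finite B\<close> \<open>B \<subseteq> V\<close> u(1) by blast
qed

lemma diagonal_basis_exists:
  fixes f g :: "'a::euclidean_space \<Rightarrow> 'a \<Rightarrow> real"
  assumes f: "bilinear f" "\<And>x y. f x y = f y x"
    and g: "bilinear g" "\<And>x y. g x y = g y x"
    and V: "subspace V"
    and pos: "\<And>x. x \<in> V \<Longrightarrow> x \<noteq> 0 \<Longrightarrow> 0 < g x x"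
  shows "\<exists>B. diagonal_basis f g V B"
  using V pos
proof (induction "dim V" arbitrary: V rule: less_induct)
  case less
  show ?case
  proof (cases "V = {0}")
    case True
    then have "diagonal_basis f g V {}" by (simp add: diagonal_basis_def)
    then show ?thesis ..
  next
    case False
    then obtain u where u: "u \<in> V" "g u u = 1" and eigen: "\<And>x. x \<in> V \<Longrightarrow> f x u = f u u * g x u"
      using symmetric_form_eigenvector[OF f g less.prems(1) _ less.prems(2)] by metis
    define V' where "V' = {x \<in> V. g x u = 0}"
    have "subspace V'"
      using less.prems(1) by (auto simp: V'_def subspace_def bilinear_lzero[OF g(1)]
          bilinear_ladd[OF g(1)] bilinear_lmul[OF g(1)])
    have "V' \<subseteq> V" "u \<notin> V'" using u(2) by (auto simp: V'_def)
    then have "span V' \<subset> span V"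
      using u(1) less.prems(1) \<open>subspace V'\<close> by (simp add: span_eq_iff[THEN iffD2]) blast
    then have "dim V' < dim V" by (rule dim_psubset)
    then obtain B where "diagonal_basis f g V' B"
      using less.hyps[OF _ \<open>subspace V'\<close>] less.prems(2) \<open>V' \<subseteq> V\<close> by blast
    then have "diagonal_basis f g V (insert u B)"
      using diagonal_basis_insert[of f g V u, OF f(2) g less.prems(1) u eigen] by (simp add: V'_def)
    then show ?thesis ..
  qed
qed

section \<open>Matrices as a Euclidean space\<close>

lemma trace_mult_transpose_eq_inner:
  fixes A B :: "real^'n^'m"
  shows "trace (A ** transpose B) = A \<bullet> B"
  by (simp add: trace_def matrix_matrix_mult_def transpose_def inner_vec_def)

lemma inner_transpose_transpose:
  fixes A B :: "real^'n^'m"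
  shows "transpose A \<bullet> transpose B = A \<bullet> B"
  unfolding transpose_def inner_vec_def by simp (rule sum.swap)

lemma trace_transpose_mult_eq_inner:
  fixes A B :: "real^'n^'m"
  shows "trace (transpose A ** B) = A \<bullet> B"
  using trace_mult_transpose_eq_inner[of "transpose A" "transpose B"]
  by (simp add: inner_transpose_transpose)

lemma transpose_add:
  fixes A B :: "'a::plus^'n^'m"
  shows "transpose (A + B) = transpose A + transpose B"
  by (simp add: transpose_def vec_eq_iff)

lemma transpose_diff:
  fixes A B :: "'a::minus^'n^'m"
  shows "transpose (A - B) = transpose A - transpose B"
  by (simp add: transpose_def vec_eq_iff)

lemma symmetric_matrix_form_commute:
  fixes A :: "real^'n^'n"
  assumes "transpose A = A"
  shows "x \<bullet> (A *v y) = y \<bullet> (A *v x)"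
  using dot_lmul_matrix[of x A y] assms by (simp add: inner_commute flip: transpose_matrix_vector)

definition sym_part :: "real^'n^'n \<Rightarrow> real^'n^'n" where
  "sym_part U = (1/2) *\<^sub>R (U + transpose U)"

lemma transpose_sym_part: "transpose (sym_part U) = sym_part U"
  by (simp add: sym_part_def transpose_scalar transpose_add add.commute)

lemma inner_sym_part:
  assumes "transpose A = A"
  shows "A \<bullet> sym_part U = A \<bullet> U"
  using inner_transpose_transpose[of A U] assms by (simp add: sym_part_def inner_add_right)

definition outer_product :: "real^'m \<Rightarrow> real^'n \<Rightarrow> real^'n^'m" where
  "outer_product u v = (\<chi> i j. u $ i * v $ j)"

lemma transpose_outer_product: "transpose (outer_product u v) = outer_product v u"
  by (simp add: outer_product_def transpose_def vec_eq_iff mult.commute)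

lemma outer_product_mult_vec: "outer_product u v *v x = (v \<bullet> x) *\<^sub>R u"
  by (simp add: outer_product_def matrix_vector_mult_def inner_vec_def vec_eq_iff
      sum_distrib_left sum_distrib_right ac_simps)

lemma inner_outer_product: "A \<bullet> outer_product u v = u \<bullet> (A *v v)"
  by (simp add: outer_product_def matrix_vector_mult_def inner_vec_def sum_distrib_left ac_simps)

lemma inner_outer_products: "outer_product u v \<bullet> outer_product x y = (u \<bullet> x) * (v \<bullet> y)"
  by (simp add: inner_outer_product outer_product_mult_vec inner_commute)

lemma sum_matrix_vector_mult:
  fixes A :: "'i \<Rightarrow> real^'n^'m"
  shows "(\<Sum>i\<in>I. A i) *v x = (\<Sum>i\<in>I. A i *v x)"
  by (rule vector_eq_ldot[THEN iffD1])
    (simp add: inner_sum_left inner_sum_right flip: inner_outer_product)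

section \<open>The semidefinite cone\<close>

lemma psd_zero: "psd 0"
  by (simp add: psd_def transpose_def vec_eq_iff)

lemma psd_add: "psd A \<Longrightarrow> psd B \<Longrightarrow> psd (A + B)"
  by (simp add: psd_def transpose_add matrix_vector_mult_add_rdistrib inner_add_right)

lemma psd_scaleR: "psd A \<Longrightarrow> 0 \<le> c \<Longrightarrow> psd (c *\<^sub>R A)"
  by (simp add: psd_def transpose_scalar scaleR_matrix_vector_assoc[symmetric])

lemma psd_sum: "(\<And>i. i \<in> I \<Longrightarrow> psd (A i)) \<Longrightarrow> psd (\<Sum>i\<in>I. A i)"
  by (induction I rule: infinite_finite_induct) (auto intro: psd_zero psd_add)

lemma psd_outer_product: "psd (outer_product v v)"
  by (simp add: psd_def transpose_outer_product outer_product_mult_vec inner_commute)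

lemma symmetric_pd_eigenbasis:
  fixes S W :: "real^'n^'n"
  assumes S: "transpose S = S" and W: "pd W"
  obtains B where "finite B"
    and "\<And>u v. u \<in> B \<Longrightarrow> v \<in> B \<Longrightarrow> u \<bullet> (W *v v) = (if u = v then 1 else 0)"
    and "\<And>u. u \<in> B \<Longrightarrow> S *v (W *v u) = ((W *v u) \<bullet> (S *v (W *v u))) *\<^sub>R u"
    and "\<And>x. (\<Sum>u\<in>B. (x \<bullet> (W *v u)) *\<^sub>R u) = x"
proof -
  define f where "f x y = (W *v x) \<bullet> (S *v (W *v y))" for x y
  define g where "g x y = x \<bullet> (W *v y)" for x y
  have W_sym: "transpose W = W" using W by (simp add: pd_def)
  have "f x y = f y x" "g x y = g y x" for x y
    unfolding f_def g_def
    by (rule symmetric_matrix_form_commute[OF S] symmetric_matrix_form_commute[OF W_sym])+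
  moreover have "bilinear f" "bilinear g"
    by (simp_all add: f_def g_def bilinear_def linear_iff inner_add_left inner_add_right
        matrix_vector_right_distrib matrix_vector_mult_scaleR)
  moreover have "0 < g x x" if "x \<noteq> 0" for x
    using W that by (simp add: pd_def g_def)
  ultimately obtain B where "diagonal_basis f g UNIV B"
    using diagonal_basis_exists[of f g UNIV] by auto
  then have "finite B"
    and orthonormal: "\<And>u v. u \<in> B \<Longrightarrow> v \<in> B \<Longrightarrow> g u v = (if u = v then 1 else 0)"
    and diagonal: "pairwise (\<lambda>u v. f u v = 0) B"
    and expand: "\<And>x. (\<Sum>u\<in>B. g x u *\<^sub>R u) = x"
    unfolding diagonal_basis_def by blast+
  have eigen: "S *v (W *v v) = f v v *\<^sub>R v" if "v \<in> B" for v
  proof -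
    have "S *v (W *v v) = (\<Sum>u\<in>B. f u v *\<^sub>R u)"
      using expand[of "S *v (W *v v)"] by (simp add: f_def g_def inner_commute)
    also have "\<dots> = (\<Sum>u\<in>B. if u = v then f v v *\<^sub>R v else 0)"
      using diagonal that by (intro sum.cong) (auto simp: pairwise_def)
    finally show ?thesis using \<open>finite B\<close> that by simp
  qed
  show ?thesis
    by (rule that[OF \<open>finite B\<close>])
      (fact orthonormal[unfolded g_def] eigen[unfolded f_def] expand[unfolded g_def])+
qed

lemma symmetric_pd_diagonalization:
  fixes S W :: "real^'n^'n"
  assumes S: "transpose S = S" and W: "pd W"
  obtains B where "finite B"
    and "\<And>u v. u \<in> B \<Longrightarrow> v \<in> B \<Longrightarrow> u \<bullet> (W *v v) = (if u = v then 1 else 0)"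
    and "S = (\<Sum>u\<in>B. ((W *v u) \<bullet> (S *v (W *v u))) *\<^sub>R outer_product u u)"
    and "W = (\<Sum>u\<in>B. outer_product (W *v u) (W *v u))"
proof -
  define c where "c u = (W *v u) \<bullet> (S *v (W *v u))" for u
  obtain B where "finite B"
    and orthonormal: "\<And>u v. u \<in> B \<Longrightarrow> v \<in> B \<Longrightarrow> u \<bullet> (W *v v) = (if u = v then 1 else 0)"
    and eigen: "\<And>u. u \<in> B \<Longrightarrow> S *v (W *v u) = c u *\<^sub>R u"
    and expand: "\<And>x. (\<Sum>u\<in>B. (x \<bullet> (W *v u)) *\<^sub>R u) = x"
    using symmetric_pd_eigenbasis[OF S W, folded c_def] by blast
  have expand_dual: "(\<Sum>u\<in>B. (u \<bullet> x) *\<^sub>R (W *v u)) = x" for x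
  proof (rule vector_eq_ldot[THEN iffD1], rule allI)
    fix y
    have "y \<bullet> (\<Sum>u\<in>B. (u \<bullet> x) *\<^sub>R (W *v u)) = (\<Sum>u\<in>B. (y \<bullet> (W *v u)) *\<^sub>R u) \<bullet> x"
      by (simp add: inner_sum_left inner_sum_right mult.commute)
    then show "y \<bullet> (\<Sum>u\<in>B. (u \<bullet> x) *\<^sub>R (W *v u)) = y \<bullet> x" by (simp only: expand)
  qed
  have W_eq: "W = (\<Sum>u\<in>B. outer_product (W *v u) (W *v u))"
  proof (rule matrix_eq[THEN iffD2], rule allI)
    fix x
    have "W *v x = (\<Sum>u\<in>B. (u \<bullet> (W *v x)) *\<^sub>R (W *v u))" by (simp only: expand_dual)
    also have "\<dots> = (\<Sum>u\<in>B. ((W *v u) \<bullet> x) *\<^sub>R (W *v u))"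
      using W symmetric_matrix_form_commute[of W _ x] by (simp add: pd_def inner_commute)
    finally show "W *v x = (\<Sum>u\<in>B. outer_product (W *v u) (W *v u)) *v x"
      by (simp add: sum_matrix_vector_mult outer_product_mult_vec)
  qed
  have S_eq: "S = (\<Sum>u\<in>B. c u *\<^sub>R outer_product u u)"
  proof (rule matrix_eq[THEN iffD2], rule allI)
    fix x
    have "S *v x = S *v (\<Sum>u\<in>B. (u \<bullet> x) *\<^sub>R (W *v u))" by (simp only: expand_dual)
    also have "\<dots> = (\<Sum>u\<in>B. (u \<bullet> x) *\<^sub>R (S *v (W *v u)))"
      by (simp add: linear_sum[OF matrix_vector_mul_linear] matrix_vector_mult_scaleR)
    also have "\<dots> = (\<Sum>u\<in>B. c u *\<^sub>R outer_product u u) *v x"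
      by (simp add: eigen sum_matrix_vector_mult outer_product_mult_vec mult.commute
          flip: scaleR_matrix_vector_assoc)
    finally show "S *v x = (\<Sum>u\<in>B. c u *\<^sub>R outer_product u u) *v x" .
  qed
  show ?thesis
    by (rule that[OF \<open>finite B\<close> orthonormal S_eq[unfolded c_def] W_eq])
qed

lemma psd_inner_nonneg:
  fixes A B :: "real^'n^'n"
  assumes A: "psd A" and B: "psd B"
  shows "0 \<le> A \<bullet> B"
proof -
  define c where "c u = u \<bullet> (B *v u)" for u
  have "pd (mat 1 :: real^'n^'n)" by (simp add: pd_def)
  then obtain X where B_eq: "B = (\<Sum>u\<in>X. c u *\<^sub>R outer_product u u)"
    using symmetric_pd_diagonalization[of B "mat 1"] B
    unfolding psd_def matrix_vector_mul_lid c_def by metis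
  have "A \<bullet> B = (\<Sum>u\<in>X. c u * (u \<bullet> (A *v u)))"
    by (subst B_eq) (simp add: inner_sum_right inner_outer_product)
  with A B show ?thesis by (simp add: psd_def c_def sum_nonneg)
qed

lemma complementary_psd_splitting:
  fixes S W :: "real^'n^'n"
  assumes "transpose S = S" and "pd W"
  obtains Sp Sm Wp Wm where "psd Sp" "psd Sm" "psd Wp" "psd Wm"
    and "S = Sp - Sm" "W = Wp + Wm" "Sp \<bullet> Wm = 0" "Sm \<bullet> Wp = 0"
proof -
  define c where "c u = (W *v u) \<bullet> (S *v (W *v u))" for u
  obtain B where "finite B"
    and orthonormal: "\<And>u v. u \<in> B \<Longrightarrow> v \<in> B \<Longrightarrow> u \<bullet> (W *v v) = (if u = v then 1 else 0)"
    and S: "S = (\<Sum>u\<in>B. c u *\<^sub>R outer_product u u)"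
    and W: "W = (\<Sum>u\<in>B. outer_product (W *v u) (W *v u))"
    using symmetric_pd_diagonalization[OF assms, folded c_def] by blast
  define P N where "P = {u \<in> B. 0 \<le> c u}" and "N = B - P"
  have "P \<subseteq> B" by (auto simp: P_def)
  have split: "sum h B = sum h N + sum h P" for h :: "real^'n \<Rightarrow> real^'n^'n"
    unfolding N_def by (rule sum.subset_diff[OF \<open>P \<subseteq> B\<close> \<open>finite B\<close>])
  define Sp Sm where "Sp = (\<Sum>u\<in>P. c u *\<^sub>R outer_product u u)"
    and "Sm = (\<Sum>u\<in>N. (- c u) *\<^sub>R outer_product u u)"
  define Wp Wm where "Wp = (\<Sum>u\<in>P. outer_product (W *v u) (W *v u))"
    and "Wm = (\<Sum>u\<in>N. outer_product (W *v u) (W *v u))"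
  have orthogonal: "u \<bullet> (W *v v) = 0" if "u \<in> P \<and> v \<in> N \<or> u \<in> N \<and> v \<in> P" for u v
    using that orthonormal[of u v] by (auto simp: P_def N_def)
  show ?thesis
  proof
    show "psd Sp" "psd Sm" "psd Wp" "psd Wm"
      unfolding Sp_def Sm_def Wp_def Wm_def
      by (auto simp: P_def N_def simp del: scaleR_minus_left
          intro!: psd_sum psd_scaleR psd_outer_product)
    show "S = Sp - Sm"
      unfolding Sp_def Sm_def by (subst S) (simp add: split sum_negf)
    show "W = Wp + Wm"
      unfolding Wp_def Wm_def by (subst W) (simp add: split)
    show "Sp \<bullet> Wm = 0" "Sm \<bullet> Wp = 0"
      unfolding Sp_def Sm_def Wp_def Wm_def inner_sum_left inner_sum_right
      by (simp_all add: inner_outer_products orthogonal)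
  qed
qed

section \<open>Support functions\<close>

lemma support_function_eqI:
  assumes "D \<in> Z" "D \<bullet> U = m" "\<And>D'. D' \<in> Z \<Longrightarrow> D' \<bullet> U \<le> m"
  shows "support_function Z U = ereal m"
  unfolding support_function_def trace_mult_transpose_eq_inner
  using assms by (intro SUP_eqI) auto

lemma inner_le_dual_norm:
  fixes N :: "real^'n^'n \<Rightarrow> real"
  assumes N: "matrix_norm N"
  shows "D \<bullet> U \<le> N D * dual_norm N U"
proof (cases "D = 0")
  case True
  moreover have "N 0 = 0" using N by (simp add: matrix_norm_def)
  ultimately show ?thesis by simp
next
  case False
  have scale: "N (c *\<^sub>R D) = \<bar>c\<bar> * N D" for c using N by (simp add: matrix_norm_def)
  have "0 < N D" using N False by (simp add: matrix_norm_def less_le)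
  then have "((1 / N D) *\<^sub>R D) \<bullet> U \<le> dual_norm N U"
    using dual_norm_max(2)[OF N, of "(1 / N D) *\<^sub>R D" U]
    by (simp add: scale trace_transpose_mult_eq_inner)
  with \<open>0 < N D\<close> show ?thesis by (simp add: field_simps)
qed

lemma support_function_norm_ball:
  fixes N :: "real^'n^'n \<Rightarrow> real"
  assumes N: "matrix_norm N" and "0 \<le> \<rho>"
  shows "support_function {D. N D \<le> \<rho>} U = ereal (\<rho> * dual_norm N U)"
proof -
  have scale: "N (c *\<^sub>R D) = \<bar>c\<bar> * N D" for c D using N by (simp add: matrix_norm_def)
  obtain B where B: "N B = 1" "B \<bullet> U = dual_norm N U"
    using dual_norm_max(1)[OF N, of U] by (auto simp: trace_transpose_mult_eq_inner)
  have nonneg: "0 \<le> dual_norm N U"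
    using inner_le_dual_norm[OF N, of "- B" U] scale[of "- 1" B] B by simp
  show ?thesis
  proof (rule support_function_eqI)
    show "\<rho> *\<^sub>R B \<in> {D. N D \<le> \<rho>}" using B(1) \<open>0 \<le> \<rho>\<close> by (simp add: scale)
    show "(\<rho> *\<^sub>R B) \<bullet> U = \<rho> * dual_norm N U" using B(2) by simp
    show "D \<bullet> U \<le> \<rho> * dual_norm N U" if "D \<in> {D. N D \<le> \<rho>}" for D
      using inner_le_dual_norm[OF N, of D U] mult_right_mono[OF _ nonneg, of "N D" \<rho>] that by simp
  qed
qed

lemma loewner_interval_duality_gap:
  fixes D Dl Du M1 M2 U :: "real^'n^'n"
  assumes "transpose D = D" "transpose M1 = M1" "transpose M2 = M2" "M2 - M1 = sym_part U"
  shows "trace (Du ** M2) - trace (Dl ** M1) = D \<bullet> U + ((Du - D) \<bullet> M2 + (D - Dl) \<bullet> M1)"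
proof -
  have "D \<bullet> U = D \<bullet> M2 - D \<bullet> M1"
    using inner_sym_part[OF assms(1), of U] by (simp add: inner_diff_right flip: assms(4))
  then show ?thesis
    using trace_mult_transpose_eq_inner[of Du M2] trace_mult_transpose_eq_inner[of Dl M1] assms(2,3)
    by (simp add: inner_diff_left)
qed

lemma loewner_interval_weak_duality:
  fixes D Dl Du M1 M2 U :: "real^'n^'n"
  assumes Dl: "transpose Dl = Dl"
    and primal: "Dl \<preceq>\<^sub>L D" "D \<preceq>\<^sub>L Du"
    and dual: "M2 - M1 = sym_part U" "0 \<preceq>\<^sub>L M1" "0 \<preceq>\<^sub>L M2"
  shows "D \<bullet> U \<le> trace (Du ** M2) - trace (Dl ** M1)"
proof -
  have psd: "psd (Du - D)" "psd (D - Dl)" "psd M1" "psd M2"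
    using primal dual by (simp_all add: loewner_le_def)
  then have "transpose D = D" "transpose M1 = M1" "transpose M2 = M2"
    using Dl by (simp_all add: psd_def transpose_diff)
  moreover have "0 \<le> (Du - D) \<bullet> M2" "0 \<le> (D - Dl) \<bullet> M1"
    using psd by (simp_all only: psd_inner_nonneg)
  ultimately show ?thesis
    by (simp add: loewner_interval_duality_gap[where D = D, OF _ _ _ dual(1)])
qed

lemma loewner_interval_complementary_slackness:
  fixes D Dl Du M1 M2 U :: "real^'n^'n"
  assumes Dl: "transpose Dl = Dl"
    and primal: "Dl \<preceq>\<^sub>L D" "D \<preceq>\<^sub>L Du"
    and dual: "M2 - M1 = sym_part U" "0 \<preceq>\<^sub>L M1" "0 \<preceq>\<^sub>L M2"
    and slack: "(Du - D) \<bullet> M2 = 0" "(D - Dl) \<bullet> M1 = 0"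
  shows "is_arg_min (\<lambda>(M1, M2). trace (Du ** M2) - trace (Dl ** M1))
      (\<lambda>(M1, M2). M2 - M1 = sym_part U \<and> 0 \<preceq>\<^sub>L M1 \<and> 0 \<preceq>\<^sub>L M2) (M1, M2)"
    and "support_function {D. Dl \<preceq>\<^sub>L D \<and> D \<preceq>\<^sub>L Du} U
      = ereal (trace (Du ** M2) - trace (Dl ** M1))"
proof -
  have "transpose D = D" "transpose M1 = M1" "transpose M2 = M2"
    using Dl primal(1) dual(2,3) by (simp_all add: loewner_le_def psd_def transpose_diff)
  then have attained: "D \<bullet> U = trace (Du ** M2) - trace (Dl ** M1)"
    by (simp add: loewner_interval_duality_gap[where D = D, OF _ _ _ dual(1)] slack)
  show "is_arg_min (\<lambda>(M1, M2). trace (Du ** M2) - trace (Dl ** M1))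
      (\<lambda>(M1, M2). M2 - M1 = sym_part U \<and> 0 \<preceq>\<^sub>L M1 \<and> 0 \<preceq>\<^sub>L M2) (M1, M2)"
    using dual loewner_interval_weak_duality[OF Dl primal]
    by (simp add: is_arg_min_linorder flip: attained)
  show "support_function {D. Dl \<preceq>\<^sub>L D \<and> D \<preceq>\<^sub>L Du} U = ereal (trace (Du ** M2) - trace (Dl ** M1))"
    using primal attained loewner_interval_weak_duality[OF Dl _ _ dual]
    by (intro support_function_eqI[of D]) auto
qed

theorem lemma3:
  fixes U :: "real^'n^'n"
  shows "(\<forall>(N :: real^'n^'n \<Rightarrow> real) (\<rho>::real). matrix_norm N \<and> 0 \<le> \<rho> \<longrightarrow>
            support_function {D. N D \<le> \<rho>} U = ereal (\<rho> * dual_norm N U)) \<and>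
         (\<forall>(Dl :: real^'n^'n) (Du :: real^'n^'n).
            transpose Dl = Dl \<and> transpose Du = Du \<and> 0 \<prec>\<^sub>L Du - Dl \<longrightarrow>
            (\<exists>L1 L2.
               is_arg_min (\<lambda>(M1, M2). trace (Du ** M2) - trace (Dl ** M1))
                 (\<lambda>(M1, M2). M2 - M1 = (1/2) *\<^sub>R (U + transpose U) \<and> 0 \<preceq>\<^sub>L M1 \<and> 0 \<preceq>\<^sub>L M2)
                 (L1, L2) \<and>
               support_function {D. Dl \<preceq>\<^sub>L D \<and> D \<preceq>\<^sub>L Du} U
                 = ereal (trace (Du ** L2) - trace (Dl ** L1))))"
  unfolding sym_part_def[symmetric]
proof (intro conjI allI impI)
  fix N :: "real^'n^'n \<Rightarrow> real" and \<rho> :: real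
  assume "matrix_norm N \<and> 0 \<le> \<rho>"
  then show "support_function {D. N D \<le> \<rho>} U = ereal (\<rho> * dual_norm N U)"
    by (simp add: support_function_norm_ball)
next
  fix Dl Du :: "real^'n^'n"
  assume "transpose Dl = Dl \<and> transpose Du = Du \<and> 0 \<prec>\<^sub>L Du - Dl"
  then have Dl: "transpose Dl = Dl" and "pd (Du - Dl)" by (simp_all add: loewner_less_def)
  then obtain Sp Sm Wp Wm where psd: "psd Sp" "psd Sm" "psd Wp" "psd Wm"
    and split: "sym_part U = Sp - Sm" "Du - Dl = Wp + Wm"
    and slack: "Sp \<bullet> Wm = 0" "Sm \<bullet> Wp = 0"
    using complementary_psd_splitting[OF transpose_sym_part] by metis
  have Wm: "Wm = Du - (Dl + Wp)" using split(2) by (simp add: algebra_simps)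
  have primal: "Dl \<preceq>\<^sub>L Dl + Wp" "Dl + Wp \<preceq>\<^sub>L Du" and dual: "0 \<preceq>\<^sub>L Sm" "0 \<preceq>\<^sub>L Sp"
    using psd by (simp_all add: loewner_le_def flip: Wm)
  have "(Du - (Dl + Wp)) \<bullet> Sp = 0" "(Dl + Wp - Dl) \<bullet> Sm = 0"
    using slack by (simp_all add: inner_commute flip: Wm)
  note optimal = loewner_interval_complementary_slackness[OF Dl primal split(1)[symmetric] dual this]
  show "\<exists>L1 L2. is_arg_min (\<lambda>(M1, M2). trace (Du ** M2) - trace (Dl ** M1))
      (\<lambda>(M1, M2). M2 - M1 = sym_part U \<and> 0 \<preceq>\<^sub>L M1 \<and> 0 \<preceq>\<^sub>L M2) (L1, L2) \<and>
    support_function {D. Dl \<preceq>\<^sub>L D \<and> D \<preceq>\<^sub>L Du} U = ereal (trace (Du ** L2) - trace (Dl ** L1))"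
    by (rule exI conjI optimal)+
qed

end
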